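(* Let $k\geqslant 1$, let $a_0,a_1,\ldots,a_k\in\mathbb Z$ and $n_0,n_1,\ldots,n_k\in\mathbb Z^+$, and let $\mathcal A=\{a_s(n_s)\}_{s=0}^k$. Let $m_1,\ldots,m_k\in\mathbb Z^+$ and put $m=\lfloor\sum_{s=1}^k m_s/n_s\rfloor$. Suppose that every integer $x$ lies in more than $m$ of the residue classes $a_0(n_0),a_1(n_1),\ldots,a_k(n_k)$, i.e. $|\{0\leqslant s\leqslant k:\ x\equiv a_s \pmod{n_s}\}|>m$ for all $x\in\mathbb Z$. Then for any real $\alpha$ with $0\leqslant\alpha<1$, either $$\sum_{\substack{I\subseteq[1,k]\\ \sum_{s\in I}m_s/n_s=(\alpha+a)/n_0}}(-1)^{|I|}e^{2\pi i\sum_{s\in I}a_sm_s/n_s}=0\quad\text{for every } a\in\mathbb N=\{0,1,2,\ldots\},$$ or $$\Big|\Big\{I\subseteq[1,k]:\ \sum_{s\in I}\frac{m_s}{n_s}=\frac{\alpha+a}{n_0}\Big\}\Big|\geqslant\binom{m}{\lfloor a/n_0\rfloor}\quad\text{for every } a\in\mathbb N.$$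
   Context: For $a\in\mathbb Z$ and $n\in\mathbb Z^+$, $a(n)$ denotes the residue class $\{x\in\mathbb Z: x\equiv a\pmod n\}$. For integers $a\leqslant b$, $[a,b]=\{x\in\mathbb Z: a\leqslant x\leqslant b\}$. Sums over $I$ range over all subsets of $[1,k]$ including the empty set (for which $\sum_{s\in I}m_s/n_s=0$ and $|I|=0$). $\lfloor\cdot\rfloor$ is the integer part; $\binom{m}{j}=0$ if $j>m$. *)

theory Defs
  imports "HOL-Analysis.Analysis" "HOL-Number_Theory.Cong"
begin

definition residue_class :: "int \<Rightarrow> nat \<Rightarrow> int set" where
  "residue_class a n = {x. [x = a] (mod int n)}"

end

theory Submission
  imports Defs "HOL-Computational_Algebra.Polynomial"
begin

text \<open>
  Let \<open>N\<close> be a common multiple of the moduli, \<open>D = N / n\<^sub>0\<close>, \<open>d\<^sub>s = m\<^sub>s N / n\<^sub>s\<close>, and let \<open>w\<close> be a primitive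
  \<open>N\<close>-th root of unity. The sums in the theorem are coefficients of
  \<open>P = \<Prod>\<^sub>s (1 - w\<^bsup>a\<^sub>s d\<^sub>s\<^esup> X\<^bsup>d\<^sub>s\<^esup>)\<close>, \<open>1 \<le> s \<le> k\<close>. The covering hypothesis makes every \<open>N\<close>-th root of unity
  a zero of order greater than \<open>M\<close> of \<open>P \<cdot> (1 - \<zeta> X\<^sup>D)\<close> with \<open>\<zeta> = w\<^bsup>a\<^sub>0 D\<^esup>\<close>, whence
  \<open>P = (1 - X\<^sup>N)\<^sup>M (\<Sum>\<^sub>r \<zeta>\<^sup>r X\<^bsup>r D\<^esup>) Q\<close>, \<open>0 \<le> r < n\<^sub>0\<close>, and \<open>degree Q < D\<close>. For \<open>t < D\<close> the coefficient
  of \<open>P\<close> at \<open>t + b D\<close> therefore has modulus \<open>M choose (b div n\<^sub>0)\<close> times that of the coefficient at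
  \<open>t\<close>. If the latter is nonzero, then for some primitive root \<open>w\<^sup>j\<close> in place of \<open>w\<close> its modulus is
  at least 1, and the number of subsets bounds the modulus of each coefficient.
\<close>

section \<open>Polynomials with integer coefficients\<close>

text \<open>Integrality is a predicate on complex polynomials, so that they can be evaluated at
  roots of unity without a coercion.\<close>

definition int_coeffs :: "complex poly \<Rightarrow> bool" where
  "int_coeffs p \<longleftrightarrow> (\<forall>i. coeff p i \<in> \<int>)"

lemma int_coeffs_monom: "c \<in> \<int> \<Longrightarrow> int_coeffs (monom c i)"
  by (simp add: int_coeffs_def coeff_monom)

lemma int_coeffs_1: "int_coeffs 1"
  using int_coeffs_monom[of 1 0] by (simp add: monom_0 one_pCons)

lemma int_coeffs_diff: "int_coeffs p \<Longrightarrow> int_coeffs q \<Longrightarrow> int_coeffs (p - q)"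
  by (simp add: int_coeffs_def)

lemma int_coeffs_sum: "(\<And>x. x \<in> A \<Longrightarrow> int_coeffs (f x)) \<Longrightarrow> int_coeffs (sum f A)"
  by (auto simp: int_coeffs_def coeff_sum intro!: Ints_sum)

lemma int_coeffs_mult: "int_coeffs p \<Longrightarrow> int_coeffs q \<Longrightarrow> int_coeffs (p * q)"
  by (auto simp: int_coeffs_def coeff_mult intro!: Ints_sum)

lemma int_coeffs_power: "int_coeffs p \<Longrightarrow> int_coeffs (p ^ n)"
  by (induction n) (auto intro: int_coeffs_1 int_coeffs_mult)

lemma int_coeffs_prod: "(\<And>x. x \<in> A \<Longrightarrow> int_coeffs (f x)) \<Longrightarrow> int_coeffs (prod f A)"
  by (induction A rule: infinite_finite_induct) (auto intro: int_coeffs_1 int_coeffs_mult)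

section \<open>Primitive roots of unity and the values of integer polynomials there\<close>

definition primitive_root_of_unity :: "nat \<Rightarrow> complex \<Rightarrow> bool" where
  "primitive_root_of_unity N w \<longleftrightarrow> N > 0 \<and> (\<forall>j. w ^ j = 1 \<longleftrightarrow> N dvd j)"

lemma primitive_root_of_unity_exp:
  assumes "N > 0"
  shows "primitive_root_of_unity N (exp (2 * of_real pi * \<i> / of_nat N))"
proof -
  have "exp (2 * of_real pi * \<i> / of_nat N) ^ j = exp (2 * of_real pi * \<i> * of_nat j / of_nat N)" for j
    by (simp add: exp_of_nat_mult [symmetric] mult_ac)
  with assms show ?thesis
    by (simp add: primitive_root_of_unity_def complex_root_unity_eq_1)
qed

lemma primitive_root_of_unity_power:
  assumes "primitive_root_of_unity N w" "coprime j N"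
  shows "primitive_root_of_unity N (w ^ j)"
  using assms
  by (simp add: primitive_root_of_unity_def power_mult [symmetric] coprime_commute
      coprime_dvd_mult_right_iff)

lemma sum_powers_root_of_unity:
  assumes "primitive_root_of_unity N w"
  shows "(\<Sum>i<N. (w ^ l) ^ i) = (if N dvd l then of_nat N else 0)"
proof (cases "N dvd l")
  case True
  then have "w ^ l = 1" using assms by (simp add: primitive_root_of_unity_def)
  with True show ?thesis by simp
next
  case False
  then have "w ^ l \<noteq> 1" using assms by (simp add: primitive_root_of_unity_def)
  moreover have "(w ^ l) ^ N = 1"
    using assms by (simp add: primitive_root_of_unity_def power_mult [symmetric])
  ultimately show ?thesis using False by (simp add: geometric_sum)
qed

text \<open>Only the exponents divisible by \<open>N\<close> survive the summation, each with weight
  \<open>N\<close>. The range starts at 1 so that it contains \<open>j = 1\<close> even when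
  \<open>N = 1\<close>.\<close>

lemma sum_poly_roots_of_unity_Ints:
  assumes w: "primitive_root_of_unity N w" and G: "int_coeffs G"
  shows "(\<Sum>j=1..N. poly G (w ^ j)) \<in> \<int>"
proof -
  have shift: "(\<Sum>j=1..N. (w ^ j) ^ i) \<in> \<int>" for i
  proof -
    have "(\<Sum>j=1..N. (w ^ j) ^ i) = (\<Sum>j<N. (w ^ Suc j) ^ i)"
      by (rule sum.reindex_bij_witness[of _ Suc "\<lambda>j. j - 1"]) auto
    also have "\<dots> = w ^ i * (\<Sum>j<N. (w ^ i) ^ j)"
      by (simp add: sum_distrib_left power_mult [symmetric] power_add [symmetric] algebra_simps)
    also have "\<dots> = (if N dvd i then of_nat N else 0)"
      using w sum_powers_root_of_unity[OF w, of i] by (simp add: primitive_root_of_unity_def)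
    also have "\<dots> \<in> \<int>" by simp
    finally show ?thesis .
  qed
  have "(\<Sum>j=1..N. poly G (w ^ j)) = (\<Sum>i\<le>degree G. coeff G i * (\<Sum>j=1..N. (w ^ j) ^ i))"
    unfolding poly_altdef sum_distrib_left by (rule sum.swap)
  also have "\<dots> \<in> \<int>"
    using G by (intro Ints_sum Ints_mult shift) (auto simp: int_coeffs_def)
  finally show ?thesis .
qed

text \<open>This replaces the norm from the cyclotomic field. The factor \<open>H\<close> vanishes at the
  non-primitive roots of unity, so if all primitive values of \<open>F\<close> had modulus less than 1, the
  discrete Fourier coefficients of \<open>H F\<^sup>r\<close> would be integers tending to 0 as \<open>r\<close> grows.\<close>

lemma exists_conjugate_norm_ge_1:
  assumes w: "primitive_root_of_unity N w" and F: "int_coeffs F" and nz: "poly F w \<noteq> 0"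
  obtains j where "coprime j N" "norm (poly F (w ^ j)) \<ge> 1"
proof (rule ccontr)
  assume "\<not> thesis"
  with that have small: "norm (poly F (w ^ j)) < 1" if "coprime j N" for j
    using that by fastforce
  have N: "N > 0" and w1: "w ^ j = 1 \<longleftrightarrow> N dvd j" for j
    using w by (auto simp: primitive_root_of_unity_def)
  define H :: "complex poly" where "H = (\<Prod>d=1..<N. monom 1 d - 1)"
  have H: "int_coeffs H"
    unfolding H_def by (intro int_coeffs_prod int_coeffs_diff int_coeffs_monom int_coeffs_1) auto
  have Hw: "poly H w \<noteq> 0"
    by (auto simp: H_def poly_prod poly_monom w1 dest: nat_dvd_not_less)
  have H0: "poly H (w ^ j) = 0" if "\<not> coprime j N" for j
  proof -
    define g where "g = gcd j N"
    have "g \<noteq> 1" "g dvd N" "g dvd j" "g > 0"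
      using that N by (auto simp: g_def coprime_iff_gcd_eq_1)
    then have g: "g > 1" by simp
    \<comment> \<open>The power of \<open>w ^ j\<close> with exponent \<open>N div g < N\<close> is
      already 1, so one of the factors of \<open>H\<close> vanishes at \<open>w ^ j\<close>.\<close>
    have "N div g \<in> {1..<N}" using g N \<open>g dvd N\<close>
      by (auto simp: Suc_le_eq div_greater_zero_iff dvd_imp_le)
    moreover have "N dvd j * (N div g)"
      using \<open>g dvd N\<close> \<open>g dvd j\<close> by (metis dvd_mult_div_cancel dvd_refl mult_dvd_mono)
    then have "(w ^ j) ^ (N div g) = 1" by (simp add: w1 flip: power_mult)
    ultimately show ?thesis
      by (auto simp: H_def poly_prod poly_monom intro!: prod_zero)
  qed
  \<comment> \<open>The monomial turns \<open>S r i\<close> into a Fourier coefficient, with index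
    \<open>i\<close>, of the values of \<open>H * F ^ r\<close> on the powers of
    \<open>w\<close>.\<close>
  define G where "G r i = H * F ^ r * monom 1 i" for r i
  define S where "S r i = (\<Sum>j=1..N. poly (G r i) (w ^ j))" for r i
  have S_Ints: "S r i \<in> \<int>" for r i
    unfolding S_def G_def using w H F
    by (intro sum_poly_roots_of_unity_Ints int_coeffs_mult int_coeffs_power int_coeffs_monom) auto
  have "(\<lambda>r. S r i) \<longlonglongrightarrow> (\<Sum>j=1..N. 0)" for i
    unfolding S_def
  proof (rule tendsto_sum)
    fix j
    show "(\<lambda>r. poly (G r i) (w ^ j)) \<longlonglongrightarrow> 0"
    proof (cases "coprime j N")
      case True
      have "(\<lambda>r. poly H (w ^ j) * poly F (w ^ j) ^ r * (w ^ j) ^ i)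
          \<longlonglongrightarrow> poly H (w ^ j) * 0 * (w ^ j) ^ i"
        by (intro tendsto_intros LIMSEQ_power_zero small True)
      then show ?thesis by (simp add: G_def poly_monom)
    qed (simp add: G_def H0)
  qed
  then have "\<forall>\<^sub>F r in sequentially. norm (S r i) < 1" for i
    using tendsto_norm[of "\<lambda>r. S r i" 0 sequentially] by (auto dest: order_tendstoD(2)[of _ _ _ 1])
  \<comment> \<open>Only finitely many \<open>i\<close> occur, so a single \<open>r\<close> serves
    them all.\<close>
  then have "\<forall>\<^sub>F r in sequentially. \<forall>i\<in>{..<N}. norm (S r i) < 1"
    by (intro eventually_ball_finite) auto
  then obtain r where r: "norm (S r i) < 1" if "i < N" for i
    by (metis (no_types, lifting) eventually_False_sequentially eventually_mono lessThan_iff)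
  have S0: "S r i = 0" if "i < N" for i
    using S_Ints[of r i] r[OF that] by (auto elim!: Ints_cases)
  \<comment> \<open>Fourier inversion at \<open>w\<close>: the exponent \<open>(N - 1) * i\<close>
    stands for \<open>- i\<close> modulo \<open>N\<close>, and only \<open>j = 1\<close> survives
    the summation over \<open>i\<close>.\<close>
  have "0 = (\<Sum>i<N. S r i * w ^ ((N - 1) * i))" by (simp add: S0)
  also have "\<dots> = (\<Sum>i<N. \<Sum>j=1..N. poly (H * F ^ r) (w ^ j) * (w ^ (j + (N - 1))) ^ i)"
    unfolding S_def sum_distrib_right
  proof (intro sum.cong refl)
    fix i j
    have "(w ^ j) ^ i * w ^ ((N - 1) * i) = (w ^ (j + (N - 1))) ^ i"
      by (simp only: power_add power_mult_distrib power_mult)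
    then show "poly (G r i) (w ^ j) * w ^ ((N - 1) * i) = poly (H * F ^ r) (w ^ j) * (w ^ (j + (N - 1))) ^ i"
      by (simp add: G_def poly_monom mult.assoc)
  qed
  also have "\<dots> = (\<Sum>j=1..N. poly (H * F ^ r) (w ^ j) * (\<Sum>i<N. (w ^ (j + (N - 1))) ^ i))"
    by (subst sum.swap) (simp add: sum_distrib_left)
  also have "\<dots> = (\<Sum>j=1..N. if j = 1 then poly (H * F ^ r) (w ^ j) * of_nat N else 0)"
  proof (rule sum.cong)
    fix j assume j: "j \<in> {1..N}"
    then have "j + (N - 1) = (j - 1) + N" by auto
    then have "N dvd j + (N - 1) \<longleftrightarrow> N dvd j - 1" by (simp only: dvd_add_triv_right_iff)
    also have "\<dots> \<longleftrightarrow> j = 1"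
    proof
      assume "N dvd j - 1"
      moreover have "j - 1 < N" using j by auto
      ultimately have "j - 1 = 0" using nat_dvd_not_less by blast
      with j show "j = 1" by auto
    qed simp
    finally show "poly (H * F ^ r) (w ^ j) * (\<Sum>i<N. (w ^ (j + (N - 1))) ^ i)
        = (if j = 1 then poly (H * F ^ r) (w ^ j) * of_nat N else 0)"
      by (simp only: sum_powers_root_of_unity[OF w]) simp
  qed simp
  also have "\<dots> = poly (H * F ^ r) w * of_nat N" using N by simp
  finally show False using N Hw nz by simp
qed

section \<open>Factoring X^N - 1 over the roots of unity\<close>

lemma prod_linear_power_dvd:
  fixes p :: "complex poly"
  assumes "finite Z" "\<And>z. z \<in> Z \<Longrightarrow> [:-z, 1:] ^ e dvd p"
  shows "(\<Prod>z\<in>Z. [:-z, 1:]) ^ e dvd p"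
  using assms
proof (induction Z rule: finite_induct)
  case (insert z Z)
  show ?case
  proof (cases "p = 0")
    case False
    let ?A = "(\<Prod>z\<in>Z. [:-z, 1:]) ^ e"
    from insert obtain q where q: "p = ?A * q" by (auto elim!: dvdE)
    \<comment> \<open>\<open>z\<close> is not a zero of the product over \<open>Z\<close>, so its
      whole multiplicity in \<open>p\<close>, at least \<open>e\<close>, comes from the cofactor
      \<open>q\<close>.\<close>
    have "poly ?A z \<noteq> 0" using insert.hyps by (auto simp: poly_prod)
    then have "order z ?A = 0" by (rule order_0I)
    with False q have "order z p = order z q" by (simp add: order_mult)
    moreover have "e \<le> order z p" using insert.prems False by (simp add: order_divides)
    ultimately have "[:-z, 1:] ^ e dvd q" by (simp add: order_divides)
    then have "[:-z, 1:] ^ e * ?A dvd p" unfolding q by (metis mult.commute mult_dvd_mono dvd_refl)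
    then show ?thesis
      using insert.hyps by (simp only: prod.insert power_mult_distrib not_False_eq_True)
  qed simp
qed simp

text \<open>Both sides are monic of degree \<open>N\<close> and vanish at the same \<open>N\<close>
  distinct points, which determines the polynomial.\<close>

lemma monom_minus_1_eq_prod:
  assumes "N > 0"
  shows "monom 1 N - 1 = (\<Prod>z | z ^ N = 1. [:-z, 1:] :: complex poly)"
proof (rule poly_eqI_degree_lead_coeff[where n = N and A = "{z. z ^ N = 1}"])
  have fin: "finite {z::complex. z ^ N = 1}" using assms by (intro finite_roots_unity) auto
  have deg: "degree (\<Prod>z | z ^ N = 1. [:-z, 1:] :: complex poly) = N"
    using assms by (subst degree_prod_sum_eq) (auto simp: card_roots_unity_eq)
  have "lead_coeff (\<Prod>z | z ^ N = 1. [:-z, 1:] :: complex poly) = 1"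
    by (simp add: lead_coeff_prod)
  with deg assms show "coeff (monom 1 N - 1) N = coeff (\<Prod>z | z ^ N = 1. [:-z, 1:] :: complex poly) N"
    by simp
  show "card {z::complex. z ^ N = 1} \<ge> N" using assms by (simp add: card_roots_unity_eq)
  show "degree (monom 1 N - 1 :: complex poly) \<le> N"
    by (intro degree_diff_le degree_monom_le) auto
  show "degree (\<Prod>z | z ^ N = 1. [:-z, 1:] :: complex poly) \<le> N" using deg by simp
  show "poly (monom 1 N - 1) z = poly (\<Prod>z | z ^ N = 1. [:-z, 1:]) z"
    if "z \<in> {z. z ^ N = 1}" for z :: complex
    using that fin by (auto simp: poly_prod poly_monom)
qed

text \<open>The powers \<open>w ^ y\<close> with \<open>y < N\<close> are distinct, and they exhaust
  the solutions of \<open>z ^ N = 1\<close> because there are only \<open>N\<close> of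
  these.\<close>

lemma roots_of_unity_eq_powers:
  assumes "primitive_root_of_unity N w" "z ^ N = 1"
  obtains y :: nat where "z = w ^ y"
proof -
  have N: "N > 0" and w1: "w ^ j = 1 \<longleftrightarrow> N dvd j" for j
    using assms by (auto simp: primitive_root_of_unity_def)
  then have "w \<noteq> 0" by (metis dvd_refl power_0_left zero_neq_one neq0_conv)
  have inj: "inj_on (\<lambda>y. w ^ y) {..<N}"
  proof (rule linorder_inj_onI)
    fix x y :: nat assume xy: "x < y" "x \<in> {..<N}" "y \<in> {..<N}"
    show "w ^ x \<noteq> w ^ y"
    proof
      assume "w ^ x = w ^ y"
      moreover have "w ^ y = w ^ x * w ^ (y - x)" using xy by (simp flip: power_add)
      ultimately have "w ^ (y - x) = 1" using \<open>w \<noteq> 0\<close> by simp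
      then show False using xy by (auto simp: w1 dest: dvd_imp_le)
    qed
  qed auto
  have "(\<lambda>y. w ^ y) ` {..<N} = {z. z ^ N = 1}"
    using N inj by (intro card_subset_eq)
      (auto simp: card_image card_roots_unity_eq finite_roots_unity w1 simp flip: power_mult)
  with assms(2) that show ?thesis by blast
qed

section \<open>Coefficients of a polynomial with a factor (1 - X^N)^M\<close>

lemma norm_coeff_of_dvd:
  fixes P :: "complex poly" and \<zeta> :: complex
  assumes P: "P \<noteq> 0" "degree P < N * (M + 1)" and N: "N = n * D" "n > 0" "D > 0"
    and \<zeta>: "\<zeta> ^ n = 1" and t: "t < D"
    and dvd: "(1 - monom 1 N) ^ (M + 1) dvd P * (1 - monom \<zeta> D)"
  shows "norm (coeff P (t + b * D)) = real (M choose (b div n)) * norm (coeff P t)"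
proof -
  have N0: "N > 0" using N by simp
  define R where "R = 1 - monom \<zeta> D"
  define Geo where "Geo = (\<Sum>r<n. monom \<zeta> D ^ r)"
  have coeff_R: "coeff R 0 = 1" using N by (simp add: R_def coeff_monom)
  then have R0: "R \<noteq> 0" by auto
  have degR: "degree R \<le> D" unfolding R_def by (intro degree_diff_le degree_monom_le) auto
  \<comment> \<open>Geometric series in \<open>monom \<zeta> D\<close>, whose power with exponent
    \<open>n\<close> is \<open>monom 1 N\<close> because \<open>\<zeta> ^ n = 1\<close>.\<close>
  have U: "1 - monom 1 N = R * Geo"
    using one_diff_power_eq[of "monom \<zeta> D" n] \<zeta> N by (simp add: R_def Geo_def monom_power mult.commute)
  have U0: "1 - monom 1 N \<noteq> (0 :: complex poly)"
  proof
    assume "1 - monom 1 N = (0 :: complex poly)"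
    then have "coeff (1 - monom 1 N :: complex poly) 0 = 0" by simp
    then show False using N0 by (simp add: coeff_monom)
  qed
  have degU: "degree (1 - monom 1 N :: complex poly) = N"
    using N0 by (intro antisym le_degree degree_diff_le degree_monom_le) auto
  obtain Q where Q: "P * R = (1 - monom 1 N) ^ (M + 1) * Q" using dvd by (auto simp: R_def elim: dvdE)
  then have "R * P = R * ((1 - monom 1 N) ^ M * Geo * Q)" using U by (simp add: mult_ac)
  with R0 have PQ: "P = (1 - monom 1 N) ^ M * Geo * Q" by simp
  have Q0: "Q \<noteq> 0" using P PQ by auto
  \<comment> \<open>The left side is below \<open>N * (M + 1) + D\<close>, which leaves less than
    \<open>D\<close> for the degree of \<open>Q\<close>.\<close>
  have "degree P + degree R = (M + 1) * N + degree Q"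
    using arg_cong[OF Q, of degree] P R0 Q0 U0
    by (subst (asm) degree_mult_eq; simp add: degree_mult_eq degree_power_eq degU)+
  with P degR have degQ: "degree Q < D" by (simp add: mult.commute)
  define c where "c q r = (-1) ^ q * of_nat (M choose q) * \<zeta> ^ r" for q r
  have "(1 - monom 1 N) ^ M = (\<Sum>q\<le>M. monom ((-1) ^ q * of_nat (M choose q)) (N * q) :: complex poly)"
  proof -
    have "(1 - monom 1 N) ^ M = (monom (-1) N + 1 :: complex poly) ^ M"
      by (simp add: minus_monom [symmetric])
    also have "\<dots> = (\<Sum>q\<le>M. of_nat (M choose q) * monom ((-1) ^ q) (N * q))"
      by (simp add: binomial_ring monom_power)
    finally show ?thesis by (simp add: of_nat_poly smult_monom mult.commute)
  qed
  then have "P = (\<Sum>q\<le>M. \<Sum>r<n. monom (c q r) (D * (q * n + r)) * Q)"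
    unfolding PQ Geo_def sum_product
    by (simp add: sum_distrib_right sum_distrib_left monom_power mult_monom c_def N algebra_simps)
  then have "coeff P (t + b * D) = (\<Sum>q\<le>M. \<Sum>r<n. coeff (monom (c q r) (D * (q * n + r)) * Q) (t + b * D))" for b
    by (simp add: coeff_sum)
  also have "\<dots> b = (\<Sum>q\<le>M. \<Sum>r<n. if r = b mod n then if q = b div n then c q r * coeff Q t else 0 else 0)" for b
  proof (intro sum.cong refl)
    fix q r assume r: "r \<in> {..<n}"
    \<comment> \<open>The monomial shifts \<open>Q\<close> into the block of exponents from
      \<open>D * u\<close> to \<open>D * u + D - 1\<close>. Blocks for different \<open>u\<close>
      are disjoint, and \<open>t + b * D\<close> lies in the block \<open>u = b\<close>.\<close>
    define u where "u = q * n + r"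
    have u: "u = b \<longleftrightarrow> r = b mod n \<and> q = b div n"
      using r by (auto simp: u_def)
    have "coeff (monom (c q r) (D * u) * Q) (t + b * D) = (if u = b then c q r * coeff Q t else 0)"
    proof (cases u b rule: linorder_cases)
      case less
      then have "D * u + D \<le> b * D"
        by (metis Suc_leI mult.commute mult_Suc_right mult_le_mono2 add.commute)
      then have "coeff Q (t + b * D - D * u) = 0" using degQ by (intro coeff_eq_0) linarith
      with less show ?thesis by (simp add: coeff_monom_mult)
    next
      case greater
      then have "b * D + D \<le> D * u"
        by (metis Suc_leI mult.commute mult_Suc_right mult_le_mono2 add.commute)
      with greater t show ?thesis by (simp add: coeff_monom_mult)
    next
      case equal
      then show ?thesis by (simp add: coeff_monom_mult mult.commute[of b D])
    qed
    with u show "coeff (monom (c q r) (D * (q * n + r)) * Q) (t + b * D)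
        = (if r = b mod n then if q = b div n then c q r * coeff Q t else 0 else 0)"
      by (simp add: u_def)
  qed
  \<comment> \<open>If \<open>b div n\<close> exceeds \<open>M\<close>, no \<open>q\<close> matches,
    and the binomial coefficient inside \<open>c\<close> is 0 as well.\<close>
  also have "\<dots> b = c (b div n) (b mod n) * coeff Q t" for b
    using N by (auto simp: c_def binomial_eq_0)
  finally have main: "coeff P (t + b * D) = c (b div n) (b mod n) * coeff Q t" for b .
  have "coeff P t = coeff Q t" using main[of 0] by (simp add: c_def)
  moreover have "norm \<zeta> = 1"
    using power_eq_1_iff[OF \<zeta>] N by simp
  ultimately show ?thesis
    using main[of b] by (simp add: c_def norm_mult norm_power)
qed

section \<open>From a covering to divisibility\<close>

text \<open>At \<open>z = w ^ y\<close> the factor for \<open>s\<close> takes the value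
  \<open>1 - w ^ ((A s + y) * d s)\<close>, which is 0 once \<open>n s\<close> divides
  \<open>A s + y\<close>. Since \<open>- y\<close> is covered more than \<open>M\<close> times, more
  than \<open>M\<close> factors vanish at \<open>z\<close>.\<close>

lemma covering_dvd:
  fixes A d n \<mu> :: "nat \<Rightarrow> nat"
  assumes w: "primitive_root_of_unity N w" and S: "finite S"
    and n: "\<And>s. s \<in> S \<Longrightarrow> n s dvd N"
    and d: "\<And>s. s \<in> S \<Longrightarrow> d s = \<mu> s * (N div n s)"
    and cover: "\<And>x::int. card {s \<in> S. [x = int (A s)] (mod int (n s))} > M"
  shows "(1 - monom 1 N) ^ (M + 1) dvd (\<Prod>s\<in>S. 1 - monom (w ^ (A s * d s)) (d s))"
proof -
  have N: "N > 0" and w1: "w ^ j = 1 \<longleftrightarrow> N dvd j" for j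
    using w by (auto simp: primitive_root_of_unity_def)
  let ?f = "\<lambda>s. 1 - monom (w ^ (A s * d s)) (d s)"
  have "[:-z, 1:] ^ (M + 1) dvd prod ?f S" if z: "z ^ N = 1" for z
  proof -
    obtain y where y: "z = w ^ y" using roots_of_unity_eq_powers[OF w z] .
    define T where "T = {s \<in> S. [- int y = int (A s)] (mod int (n s))}"
    have "[:-z, 1:] ^ (M + 1) dvd [:-z, 1:] ^ card T"
      using cover[of "- int y"] by (intro le_imp_power_dvd) (simp add: T_def)
    also have "[:-z, 1:] ^ card T = (\<Prod>s\<in>T. [:-z, 1:])" by simp
    also have "\<dots> dvd prod ?f T"
    proof (rule prod_dvd_prod)
      fix s assume s: "s \<in> T"
      then have "int (n s) dvd - int y - int (A s)" by (simp add: T_def cong_iff_dvd_diff)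
      then have "int (n s) dvd int (A s + y)" by (metis dvd_minus_iff minus_diff_eq diff_minus_eq_add of_nat_add)
      then have "n s * (N div n s) dvd (A s + y) * (N div n s)" by (simp only: int_dvd_int_iff mult_dvd_mono dvd_refl)
      then have "N dvd (A s + y) * (N div n s)"
        using s n by (simp only: T_def mem_Collect_eq dvd_mult_div_cancel)
      then have "N dvd A s * d s + y * d s" using s d
        by (simp add: T_def flip: add_mult_distrib) (simp add: mult.left_commute)
      then have "w ^ (A s * d s) * z ^ d s = 1" by (simp add: w1 y flip: power_mult power_add)
      then show "[:-z, 1:] dvd ?f s" by (simp add: poly_monom flip: poly_eq_0_iff_dvd)
    qed
    also have "\<dots> dvd prod ?f S"
      using S by (intro prod_dvd_prod_subset) (auto simp: T_def)
    finally show ?thesis .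
  qed
  then have "(monom 1 N - 1) ^ (M + 1) dvd prod ?f S"
    unfolding monom_minus_1_eq_prod[OF N] using N
    by (intro prod_linear_power_dvd finite_roots_unity) auto
  \<comment> \<open>The two powers differ at most by a sign.\<close>
  moreover have "(1 - monom 1 N :: complex poly) ^ (M + 1) dvd (monom 1 N - 1) ^ (M + 1)"
    by (rule dvd_power_same) (metis dvd_refl minus_diff_eq minus_dvd_iff)
  ultimately show ?thesis by (rule dvd_trans[rotated])
qed

section \<open>Subset sums as coefficients, exponentials as powers of a root of unity\<close>

lemma coeff_prod_one_minus_monom:
  fixes c :: "'a \<Rightarrow> complex"
  assumes "finite S"
  shows "coeff (\<Prod>s\<in>S. 1 - monom (c s) (d s)) e
    = (\<Sum>I | I \<subseteq> S \<and> sum d I = e. (-1) ^ card I * prod c I)"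
proof -
  have monom_prod: "(\<Prod>s\<in>I. monom (c s) (d s)) = monom (prod c I) (sum d I)" for I
    by (induction I rule: infinite_finite_induct) (auto simp: mult_monom)
  have "coeff (\<Prod>s\<in>S. 1 - monom (c s) (d s)) e
      = (\<Sum>I\<in>Pow S. coeff (monom ((-1) ^ card I * prod c I) (sum d I)) e)"
  proof -
    have "(-1) ^ card I * monom (prod c I) (sum d I) = monom ((-1) ^ card I * prod c I) (sum d I)" for I
      by (cases "even (card I)") (simp_all add: minus_monom)
    then show ?thesis
      by (simp add: prod_diff_conv_sum assms monom_prod coeff_sum)
  qed
  also have "\<dots> = (\<Sum>I\<in>Pow S. if sum d I = e then (-1) ^ card I * prod c I else 0)"
    by (simp add: coeff_monom)
  also have "\<dots> = (\<Sum>I | I \<subseteq> S \<and> sum d I = e. (-1) ^ card I * prod c I)"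
    using assms by (subst sum.inter_filter [symmetric]) (auto intro!: sum.cong)
  finally show ?thesis .
qed

text \<open>Since \<open>n\<close> divides \<open>N\<close>, reducing \<open>a\<close> modulo
  \<open>N\<close> changes the argument of \<open>exp\<close> by an integer multiple of 2 pi i. The
  reduced residue yields a natural exponent.\<close>

lemma exp_residue_eq_root_power:
  fixes a :: int
  assumes "N > 0" "n > 0" "n dvd N"
  shows "exp (2 * complex_of_real pi * \<i> * (of_int a * of_nat m / of_nat n))
    = exp (2 * of_real pi * \<i> / of_nat N) ^ (nat (a mod int N) * (m * (N div n)))"
proof -
  define A where "A = nat (a mod int N)"
  define q where "q = a div int N"
  obtain r where r: "N = n * r" using assms by (auto elim: dvdE)
  then have r0: "r > 0" using assms by simp
  have a: "a = int A + int N * q" using assms by (simp add: A_def q_def)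
  have "2 * complex_of_real pi * \<i> * (of_int a * of_nat m / of_nat n)
    = of_nat (A * (m * r)) * (2 * of_real pi * \<i> / of_nat N)
      + 2 * of_int (q * int m * int r) * of_real pi * \<i>"
    using assms r r0 by (simp add: a field_simps)
  moreover have "exp (2 * of_int (q * int m * int r) * of_real pi * \<i>) = 1"
    using exp_2pi_1_int[of "q * int m * int r"] by (simp only: mult_ac)
  ultimately show ?thesis
    using assms r by (simp add: exp_add A_def flip: exp_of_nat_mult)
qed

section \<open>The dichotomy for subset sums\<close>

theorem theorem1p1:
  fixes k :: nat and a :: "nat \<Rightarrow> int" and n m :: "nat \<Rightarrow> nat" and M :: nat and \<alpha> :: real
  assumes "k \<ge> 1"
    and "\<And>s. s \<in> {0..k} \<Longrightarrow> n s > 0"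
    and "\<And>s. s \<in> {1..k} \<Longrightarrow> m s > 0"
    and "M = nat \<lfloor>\<Sum>s\<in>{1..k}. real (m s) / real (n s)\<rfloor>"
    and "\<And>x::int. card {s \<in> {0..k}. x \<in> residue_class (a s) (n s)} > M"
    and "0 \<le> \<alpha>" and "\<alpha> < 1"
  shows "(\<forall>b::nat. (\<Sum>I | I \<subseteq> {1..k} \<and> (\<Sum>s\<in>I. real (m s) / real (n s)) = (\<alpha> + real b) / real (n 0).
              (-1) ^ card I *
              exp (2 * complex_of_real pi * \<i> *
                   (\<Sum>s\<in>I. of_int (a s) * of_nat (m s) / of_nat (n s)))) = (0::complex))
       \<or> (\<forall>b::nat. card {I. I \<subseteq> {1..k} \<and> (\<Sum>s\<in>I. real (m s) / real (n s)) = (\<alpha> + real b) / real (n 0)}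
              \<ge> M choose nat \<lfloor>real b / real (n 0)\<rfloor>)"
proof (cases "\<exists>I b. I \<subseteq> {1..k} \<and> (\<Sum>s\<in>I. real (m s) / real (n s)) = (\<alpha> + real b) / real (n 0)")
  case False
  \<comment> \<open>No subset attains any of the values, so every sum is empty and the first
    alternative holds.\<close>
  then have "{I. I \<subseteq> {1..k} \<and> (\<Sum>s\<in>I. real (m s) / real (n s)) = (\<alpha> + real b) / real (n 0)} = {}" for b
    by blast
  then show ?thesis by (simp only: sum.empty) simp
next
  case True
  then obtain I0 b0 where I0: "I0 \<subseteq> {1..k}"
    "(\<Sum>s\<in>I0. real (m s) / real (n s)) = (\<alpha> + real b0) / real (n 0)" by blast
  have npos: "n s > 0" if "s \<le> k" for s using assms(2) that by simp
  define N where "N = (\<Prod>s\<in>{0..k}. n s)"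
  define D where "D = N div n 0"
  define A where "A s = nat (a s mod int N)" for s
  \<comment> \<open>Setting \<open>\<mu> 0 = 1\<close> gives \<open>d 0 = D\<close>, so the factor
    for \<open>s = 0\<close> is \<open>1 - monom (z ^ (A 0 * D)) D\<close>.\<close>
  define \<mu> where "\<mu> = m(0 := 1)"
  define d where "d s = \<mu> s * (N div n s)" for s
  define w where "w = exp (2 * of_real pi * \<i> / of_nat N)"
  define K where "K b = {I. I \<subseteq> {1..k} \<and> (\<Sum>s\<in>I. real (m s) / real (n s)) = (\<alpha> + real b) / real (n 0)}" for b
  have N: "N > 0" using npos by (auto simp: N_def)
  have nN: "n s dvd N" if "s \<le> k" for s using that by (auto simp: N_def intro!: dvd_prodI)
  have ND: "N = n 0 * D" using nN by (simp add: D_def)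
  have D: "D > 0" using N ND by simp
  have w: "primitive_root_of_unity N w" unfolding w_def by (rule primitive_root_of_unity_exp[OF N])
  have dm: "d s = m s * (N div n s)" if "s \<in> {1..k}" for s
    using that by (simp add: d_def \<mu>_def)
  have real_d: "real (sum d I) = real N * (\<Sum>s\<in>I. real (m s) / real (n s))" if "I \<subseteq> {1..k}" for I
    unfolding of_nat_sum sum_distrib_left
    by (rule sum.cong) (use that npos nN in \<open>auto simp: dm real_of_nat_div subset_iff\<close>)
  have sum_iff: "(\<Sum>s\<in>I. real (m s) / real (n s)) = (\<alpha> + real b) / real (n 0)
      \<longleftrightarrow> real (sum d I) = (\<alpha> + real b) * real D" if "I \<subseteq> {1..k}" for I b
  proof -
    have "real N * x = (\<alpha> + real b) * real D \<longleftrightarrow> x = (\<alpha> + real b) / real (n 0)" for x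
    proof -
      have "real N * x = (x * real (n 0)) * real D" by (simp add: ND)
      then have "real N * x = (\<alpha> + real b) * real D \<longleftrightarrow> x * real (n 0) = \<alpha> + real b"
        using D by (simp only: mult_cancel_right) simp
      then show ?thesis using npos[of 0] by (simp add: eq_divide_eq)
    qed
    then show ?thesis unfolding real_d[OF that] by simp
  qed
  \<comment> \<open>\<open>t\<close> equals \<open>\<alpha> * real D\<close>: the subset
    \<open>I0\<close> shows that this number is natural, and \<open>\<alpha> < 1\<close> puts it
    below \<open>D\<close>.\<close>
  define t where "t = sum d I0 - b0 * D"
  have "real (sum d I0) = (\<alpha> + real b0) * real D" using I0 sum_iff by blast
  then have eq: "real (sum d I0) = \<alpha> * real D + real (b0 * D)" by (simp add: distrib_right)
  moreover have "\<alpha> * real D \<ge> 0" using assms(6) by simp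
  ultimately have "real (b0 * D) \<le> real (sum d I0)" by linarith
  then have "b0 * D \<le> sum d I0" by (simp only: of_nat_le_iff)
  then have \<alpha>D: "\<alpha> * real D = real t" using eq by (simp add: t_def)
  have "\<alpha> * real D < 1 * real D" using assms(7) D by (intro mult_strict_right_mono) auto
  then have t: "t < D" by (simp add: \<alpha>D)
  have K: "K b = {I. I \<subseteq> {1..k} \<and> sum d I = t + b * D}" for b
  proof -
    have "real (sum d I) = (\<alpha> + real b) * real D \<longleftrightarrow> sum d I = t + b * D" for I
      by (simp only: distrib_right \<alpha>D of_nat_eq_iff flip: of_nat_mult of_nat_add)
    then show ?thesis using sum_iff by (auto simp: K_def)
  qed
  \<comment> \<open>\<open>z\<close> stays a parameter because the primitive root \<open>w\<close>
    is later replaced by \<open>w ^ j\<close>.\<close>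
  define P where "P z = (\<Prod>s\<in>{1..k}. 1 - monom (z ^ (A s * d s)) (d s))" for z :: complex
  have coeff_P: "coeff (P z) e = (\<Sum>I | I \<subseteq> {1..k} \<and> sum d I = e. (-1) ^ card I * z ^ (\<Sum>s\<in>I. A s * d s))" for z e
    by (simp add: P_def coeff_prod_one_minus_monom power_sum)
  have norm_P: "norm (coeff (P z) (t + b * D)) = real (M choose (b div n 0)) * norm (coeff (P z) t)"
    if z: "primitive_root_of_unity N z" for z b
  proof (rule norm_coeff_of_dvd[where N = N])
    have dpos: "d s > 0" if "s \<in> {1..k}" for s
      using that assms(3) npos[of s] nN[of s] N by (auto simp: dm div_greater_zero_iff dvd_imp_le)
    have "coeff (1 - monom (z ^ (A s * d s)) (d s)) 0 = 1" if "s \<in> {1..k}" for s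
      using dpos[OF that] by (simp add: coeff_monom)
    then have nz: "1 - monom (z ^ (A s * d s)) (d s) \<noteq> 0" if "s \<in> {1..k}" for s
      using that by (metis coeff_0 zero_neq_one)
    then show "P z \<noteq> 0" by (simp add: P_def)
    have "degree (P z) = (\<Sum>s=1..k. degree (1 - monom (z ^ (A s * d s)) (d s)))"
      unfolding P_def by (rule degree_prod_sum_eq) (rule nz)
    also have "\<dots> \<le> (\<Sum>s=1..k. d s)"
      by (intro sum_mono degree_diff_le degree_monom_le) auto
    also have "\<dots> < N * (M + 1)"
    proof -
      \<comment> \<open>The floor in \<open>M\<close> enters here: it is what bounds the degree of
        \<open>P z\<close>.\<close>
      have "(\<Sum>s=1..k. real (m s) / real (n s)) < real (M + 1)"
        unfolding assms(4) by linarith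
      then have "real (\<Sum>s=1..k. d s) < real N * real (M + 1)" using N by (subst real_d) auto
      then show ?thesis by (simp only: of_nat_less_iff flip: of_nat_mult)
    qed
    finally show "degree (P z) < N * (M + 1)" .
    show "N = n 0 * D" "n 0 > 0" "D > 0" "t < D" using ND D npos t by auto
    show "(z ^ (A 0 * D)) ^ n 0 = 1"
      using z by (simp add: primitive_root_of_unity_def ND mult_ac flip: power_mult)
    have "(1 - monom 1 N) ^ (M + 1) dvd (\<Prod>s\<in>{0..k}. 1 - monom (z ^ (A s * d s)) (d s))"
    proof (rule covering_dvd[OF z])
      fix x :: int
      have "[x = int (A s)] (mod int (n s)) \<longleftrightarrow> x \<in> residue_class (a s) (n s)" if "s \<le> k" for s
      proof -
        have "a s mod int N mod int (n s) = a s mod int (n s)"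
          using nN[OF that] by (simp add: mod_mod_cancel)
        then show ?thesis using N by (simp add: residue_class_def A_def cong_def)
      qed
      then have "{s \<in> {0..k}. [x = int (A s)] (mod int (n s))} = {s \<in> {0..k}. x \<in> residue_class (a s) (n s)}"
        by auto
      then show "M < card {s \<in> {0..k}. [x = int (A s)] (mod int (n s))}" using assms(5) by simp
    qed (auto simp: nN d_def)
    also have "{0..k} = insert 0 {1..k}" by auto
    finally show "(1 - monom 1 N) ^ (M + 1) dvd P z * (1 - monom (z ^ (A 0 * D)) D)"
      by (simp add: P_def d_def \<mu>_def D_def mult.commute)
  qed
  have sum_P: "(\<Sum>I\<in>K b. (-1) ^ card I * exp (2 * complex_of_real pi * \<i> *
      (\<Sum>s\<in>I. of_int (a s) * of_nat (m s) / of_nat (n s)))) = coeff (P w) (t + b * D)" for b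
    unfolding coeff_P K
  proof (intro sum.cong refl arg_cong2[where f = "(*)"])
    fix I assume "I \<in> {I. I \<subseteq> {1..k} \<and> sum d I = t + b * D}"
    then have I: "I \<subseteq> {1..k}" and "finite I" by (auto intro: finite_subset)
    have "exp (2 * complex_of_real pi * \<i> * (of_int (a s) * of_nat (m s) / of_nat (n s))) = w ^ (A s * d s)"
      if "s \<in> I" for s
    proof -
      have "s \<in> {1..k}" using that I by auto
      then show ?thesis
        using exp_residue_eq_root_power[OF N npos nN, of s "a s" "m s"] by (simp add: w_def A_def dm)
    qed
    then show "exp (2 * complex_of_real pi * \<i> * (\<Sum>s\<in>I. of_int (a s) * of_nat (m s) / of_nat (n s)))
        = w ^ (\<Sum>s\<in>I. A s * d s)"
      using \<open>finite I\<close> by (simp only: sum_distrib_left exp_sum power_sum) simp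
  qed
  show ?thesis
  proof (cases "coeff (P w) t = 0")
    case True
    \<comment> \<open>By \<open>norm_P\<close> a zero coefficient at \<open>t\<close> forces zeros
      at every \<open>t + b * D\<close>, which is the first alternative.\<close>
    then have "coeff (P w) (t + b * D) = 0" for b using norm_P[OF w, of b] by simp
    then show ?thesis using sum_P by (simp add: K_def)
  next
    case False
    \<comment> \<open>The coefficient of \<open>P z\<close> at \<open>t\<close> is itself an integer
      polynomial in \<open>z\<close>, so passing from \<open>w\<close> to a conjugate
      \<open>w ^ j\<close> means evaluating \<open>F\<close> at another point.\<close>
    define F :: "complex poly" where "F = (\<Sum>I\<in>K 0. monom ((-1) ^ card I) (\<Sum>s\<in>I. A s * d s))"
    have F: "poly F z = coeff (P z) t" for z
      by (simp add: F_def poly_sum poly_monom coeff_P K)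
    have "int_coeffs F"
      unfolding F_def by (intro int_coeffs_sum int_coeffs_monom) auto
    then obtain j where j: "coprime j N" "norm (poly F (w ^ j)) \<ge> 1"
      using exists_conjugate_norm_ge_1[OF w, of F] F False by metis
    have "card (K b) \<ge> M choose (b div n 0)" for b
    proof -
      have z: "primitive_root_of_unity N (w ^ j)" using w j by (intro primitive_root_of_unity_power)
      \<comment> \<open>This makes every term of the coefficient unimodular, so the triangle
        inequality counts subsets.\<close>
      have "norm w = 1" unfolding w_def by (simp add: norm_exp_eq_Re)
      then have "norm (coeff (P (w ^ j)) (t + b * D)) \<le> (\<Sum>I\<in>K b. 1)"
        unfolding coeff_P K by (intro sum_norm_le) (simp add: norm_mult norm_power)
      moreover have "real (M choose (b div n 0)) * 1 \<le> norm (coeff (P (w ^ j)) (t + b * D))"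
        unfolding norm_P[OF z] using j F by (intro mult_left_mono) auto
      ultimately show ?thesis by simp
    qed
    then show ?thesis by (simp add: K_def floor_divide_of_nat_eq)
  qed
qed

end
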